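(* Let $M$ be a compact Riemannian manifold without boundary with a system of self-adjoint, commuting, jointly elliptic differential operators $L_1,\dots,L_m$, with joint eigenbasis $e_j$, $j\in\mathbb N$, and joint spectrum $\Lambda\subset\mathbb R^m$. Let $E\subset M$ be measurable, let $S$ be a finite subset of the joint spectrum $\Lambda$, and let $X_S=\{j:\lambda_j\in S\}$, where $\lambda_j=(\lambda_{1,j},\dots,\lambda_{m,j})$ is the vector of eigenvalues of $L_1,\dots,L_m$ associated with the eigenfunction $e_j$. Suppose there is a nontrivial $f\in L^2(M)$ that is $L^2$-concentrated in $E$ at level $L$ and whose Fourier coefficients $\widehat f$ are $L^2$-concentrated in $X_S$ at level $L'$. Then $$\sum_{j\in X_S}\int_E|e_j(x)|^2\,dx\ge(1-\epsilon-\epsilon')^2,$$ where $L=(1-\epsilon^2)^{-1/2}$ and $L'=(1-\epsilon'^2)^{-1/2}$ with $\epsilon,\epsilon'\in[0,1)$.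
   Context: $dx$ denotes the volume density on $M$. The hypotheses on the operators mean: (i) each $L_i$ is self-adjoint in $L^2(dx)$; (ii) $L_i$ and $L_j$ commute for all $i,j$; (iii) $L_1,\dots,L_m$ are jointly elliptic, i.e. $T:=I+\sum_{i=1}^mL_i^2$ is an elliptic differential operator on $M$. Such a system admits a discrete orthonormal basis $\{e_j:j\in\mathbb N\}$ of $L^2(M)$ consisting of joint eigenfunctions, $L_ie_j=\lambda_{i,j}e_j$ for all $i,j$; the joint spectrum is $\Lambda=\{(\lambda_{1,j},\dots,\lambda_{m,j}):j\in\mathbb N\}\subset\mathbb R^m$. The Fourier coefficients of $f$ are $\widehat f(j)=\int_M f\,\overline{e_j}\,dx$, viewed as a function on $\mathbb N$ with counting measure. Concentration: if $X$ is a measure space with measure $\mu$ and $E\subset X$, a function $f\in L^p(X,\mu)$ is $L^p$-concentrated on (in) $E$ at level $L\ge1$ if $\left(\int_X|f|^p\,d\mu\right)^{1/p}\le L\left(\int_E|f|^p\,d\mu\right)^{1/p}$.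
   Formalization: The formal statement adds the hypothesis ε + ε' ≤ 1; without it the claim is false (circle of length 1, f = e_0 = 1, S = {0}, |E| = 0.19, ε = ε' = 0.9 gives 0.19 on the left and 0.64 on the right). *)

theory Defs
  imports "HOL-Analysis.Analysis"
begin

section \<open>Smooth functions on open subsets of Euclidean space\<close>

text \<open>Both notions are meant for open \<open>S\<close>, where \<open>frechet_derivative f (at x)\<close> is determined by
  the values of \<open>f\<close> on \<open>S\<close>.\<close>

primrec Ck_on :: "nat \<Rightarrow> 'a::real_normed_vector set \<Rightarrow> ('a \<Rightarrow> 'b::real_normed_vector) \<Rightarrow> bool" where
  "Ck_on 0 S f \<longleftrightarrow> continuous_on S f"
| "Ck_on (Suc k) S f \<longleftrightarrow>
     (\<forall>x\<in>S. f differentiable (at x)) \<and> (\<forall>v. Ck_on k S (\<lambda>x. frechet_derivative f (at x) v))"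

definition smooth_on :: "'a::real_normed_vector set \<Rightarrow> ('a \<Rightarrow> 'b::real_normed_vector) \<Rightarrow> bool" where
  "smooth_on S f \<longleftrightarrow> (\<forall>k. Ck_on k S f)"

text \<open>\<open>partials [i\<^sub>1, \<dots>, i\<^sub>r] f\<close> is the iterated partial derivative of \<open>f\<close> in the coordinate
  directions \<open>i\<^sub>1, \<dots>, i\<^sub>r\<close>.\<close>

primrec partials :: "'n::finite list \<Rightarrow> (real ^ 'n \<Rightarrow> complex) \<Rightarrow> real ^ 'n \<Rightarrow> complex" where
  "partials [] f = f"
| "partials (i # is) f = (\<lambda>y. frechet_derivative (partials is f) (at y) (axis i 1))"


section \<open>Compact Riemannian manifolds without boundary\<close>

text \<open>A chart is a pair \<open>(U, \<phi>)\<close> of its domain and its coordinate map; only the values of \<open>\<phi>\<close> on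
  \<open>U\<close> matter. All charts take values in open subsets of Euclidean space, so there is no boundary.
  The manifold is a subset \<open>M\<close> of a Hausdorff space, with the subspace topology; it need not be
  connected.\<close>

type_synonym ('a, 'n) chart = "'a set \<times> ('a \<Rightarrow> real ^ 'n)"

definition transition :: "('a, 'n::finite) chart \<Rightarrow> ('a, 'n) chart \<Rightarrow> real ^ 'n \<Rightarrow> real ^ 'n" where
  "transition c d = snd d \<circ> inv_into (fst c) (snd c)"

definition smooth_atlas :: "'a::t2_space set \<Rightarrow> ('a, 'n::finite) chart set \<Rightarrow> bool" where
  "smooth_atlas M A \<longleftrightarrow>
     (\<Union>c\<in>A. fst c) = M \<and>
     (\<forall>(U, \<phi>)\<in>A. openin (top_of_set M) U \<and> open (\<phi> ` U) \<and>
        homeomorphism U (\<phi> ` U) \<phi> (inv_into U \<phi>)) \<and>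
     (\<forall>(U, \<phi>)\<in>A. \<forall>(V, \<psi>)\<in>A. smooth_on (\<phi> ` (U \<inter> V)) (transition (U, \<phi>) (V, \<psi>)))"

text \<open>A Riemannian metric is given by its Gram matrices \<open>g c y\<close>, one for each chart \<open>c\<close> and each
  point \<open>y\<close> of the image of \<open>c\<close>, transforming as a symmetric covariant 2-tensor under changes of
  coordinates.\<close>

definition riemannian_metric ::
  "('a, 'n::finite) chart set \<Rightarrow> (('a, 'n) chart \<Rightarrow> real ^ 'n \<Rightarrow> real ^ 'n ^ 'n) \<Rightarrow> bool" where
  "riemannian_metric A g \<longleftrightarrow>
     (\<forall>(U, \<phi>)\<in>A. smooth_on (\<phi> ` U) (g (U, \<phi>)) \<and>
        (\<forall>y\<in>\<phi> ` U. transpose (g (U, \<phi>) y) = g (U, \<phi>) y \<and>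
           (\<forall>v. v \<noteq> 0 \<longrightarrow> 0 < v \<bullet> (g (U, \<phi>) y *v v)))) \<and>
     (\<forall>(U, \<phi>)\<in>A. \<forall>(V, \<psi>)\<in>A. \<forall>y\<in>\<phi> ` (U \<inter> V).
        let \<tau> = transition (U, \<phi>) (V, \<psi>); J = matrix (frechet_derivative \<tau> (at y))
        in g (U, \<phi>) y = transpose J ** g (V, \<psi>) (\<tau> y) ** J)"

definition compact_riemannian_manifold ::
  "'a::t2_space set \<Rightarrow> ('a, 'n::finite) chart set \<Rightarrow>
   (('a, 'n) chart \<Rightarrow> real ^ 'n \<Rightarrow> real ^ 'n ^ 'n) \<Rightarrow> bool" where
  "compact_riemannian_manifold M A g \<longleftrightarrow> compact M \<and> smooth_atlas M A \<and> riemannian_metric A g"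

text \<open>The Riemannian volume \<open>dx\<close> is the measure on \<open>M\<close> that in every chart has density
  \<open>sqrt (det g)\<close> with respect to Lebesgue measure. It is completed, so that its measurable sets
  are the Lebesgue measurable subsets of \<open>M\<close> and not only the Borel sets.\<close>

definition riemannian_volume ::
  "'a::t2_space set \<Rightarrow> ('a, 'n::finite) chart set \<Rightarrow>
   (('a, 'n) chart \<Rightarrow> real ^ 'n \<Rightarrow> real ^ 'n ^ 'n) \<Rightarrow> 'a measure \<Rightarrow> bool" where
  "riemannian_volume M A g dx \<longleftrightarrow>
     (\<exists>\<nu>. sets \<nu> = sets (restrict_space borel M) \<and>
        (\<forall>(U, \<phi>)\<in>A. \<forall>B\<in>sets \<nu>. B \<subseteq> U \<longrightarrow>
           emeasure \<nu> B = (\<integral>\<^sup>+y\<in>\<phi> ` B. ennreal (sqrt (det (g (U, \<phi>) y))) \<partial>lborel)) \<and>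
        dx = completion \<nu>)"


section \<open>Lebesgue spaces, orthonormal bases and concentration\<close>

text \<open>Elements of \<open>Lp_space\<close> are functions, not classes modulo almost everywhere equality.\<close>

definition Lp_space :: "'a measure \<Rightarrow> real \<Rightarrow> ('a \<Rightarrow> 'b::{banach,second_countable_topology}) set" where
  "Lp_space \<mu> p = {f \<in> borel_measurable \<mu>. integrable \<mu> (\<lambda>x. norm (f x) powr p)}"

definition Lp_norm :: "'a measure \<Rightarrow> real \<Rightarrow> ('a \<Rightarrow> 'b::{banach,second_countable_topology}) \<Rightarrow> real" where
  "Lp_norm \<mu> p f = (LINT x|\<mu>. norm (f x) powr p) powr (1 / p)"

definition Lp_concentrated ::
  "'a measure \<Rightarrow> real \<Rightarrow> 'a set \<Rightarrow> real \<Rightarrow> ('a \<Rightarrow> 'b::{banach,second_countable_topology}) \<Rightarrow> bool" where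
  "Lp_concentrated \<mu> p E L f \<longleftrightarrow>
     1 \<le> L \<and> f \<in> Lp_space \<mu> p \<and>
     (LINT x|\<mu>. norm (f x) powr p) powr (1 / p) \<le> L * (LINT x:E|\<mu>. norm (f x) powr p) powr (1 / p)"

definition L2_inner :: "'a measure \<Rightarrow> ('a \<Rightarrow> complex) \<Rightarrow> ('a \<Rightarrow> complex) \<Rightarrow> complex" where
  "L2_inner \<mu> f h = (LINT x|\<mu>. f x * cnj (h x))"

text \<open>Orthonormal with dense linear span.\<close>

definition orthonormal_basis :: "'a measure \<Rightarrow> (nat \<Rightarrow> 'a \<Rightarrow> complex) \<Rightarrow> bool" where
  "orthonormal_basis \<mu> e \<longleftrightarrow>
     (\<forall>j. e j \<in> Lp_space \<mu> 2) \<and>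
     (\<forall>i j. L2_inner \<mu> (e i) (e j) = (if i = j then 1 else 0)) \<and>
     (\<forall>f\<in>Lp_space \<mu> 2. \<forall>\<delta>>0. \<exists>N c. Lp_norm \<mu> 2 (\<lambda>x. f x - (\<Sum>j<N. c j * e j x)) < \<delta>)"

definition fourier_coeff ::
  "'a measure \<Rightarrow> (nat \<Rightarrow> 'a \<Rightarrow> complex) \<Rightarrow> ('a \<Rightarrow> complex) \<Rightarrow> nat \<Rightarrow> complex" where
  "fourier_coeff \<mu> e f j = L2_inner \<mu> f (e j)"


section \<open>Differential operators\<close>

definition smooth_functions :: "('a, 'n::finite) chart set \<Rightarrow> ('a \<Rightarrow> complex) set" where
  "smooth_functions A = {u. \<forall>(U, \<phi>)\<in>A. smooth_on (\<phi> ` U) (u \<circ> inv_into U \<phi>)}"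

text \<open>In the chart \<open>c\<close> the operator \<open>P\<close> has order at most \<open>k\<close> and smooth coefficients \<open>a\<close>. The sum is
  over lists of coordinate indices, so a multi-index \<open>\<alpha>\<close> occurs once for every list that sorts
  to it. The coefficient of \<open>\<partial>\<^sup>\<alpha>\<close> is the sum of the \<open>a is\<close> over these lists, and the family
  \<open>a\<close> is not unique; the operators represented and the principal symbol are the usual ones.\<close>

definition local_form ::
  "('a, 'n::finite) chart set \<Rightarrow> ('a, 'n) chart \<Rightarrow> nat \<Rightarrow> (('a \<Rightarrow> complex) \<Rightarrow> 'a \<Rightarrow> complex) \<Rightarrow>
   ('n list \<Rightarrow> real ^ 'n \<Rightarrow> complex) \<Rightarrow> bool" where
  "local_form A c k P a \<longleftrightarrow> (case c of (U, \<phi>) \<Rightarrow>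
     (\<forall>is. length is \<le> k \<longrightarrow> smooth_on (\<phi> ` U) (a is)) \<and>
     (\<forall>u\<in>smooth_functions A. \<forall>y\<in>\<phi> ` U.
        P u (inv_into U \<phi> y) = (\<Sum>is | length is \<le> k. a is y * partials is (u \<circ> inv_into U \<phi>) y)))"

definition differential_operator ::
  "('a, 'n::finite) chart set \<Rightarrow> (('a \<Rightarrow> complex) \<Rightarrow> 'a \<Rightarrow> complex) \<Rightarrow> bool" where
  "differential_operator A P \<longleftrightarrow> (\<exists>k. \<forall>c\<in>A. \<exists>a. local_form A c k P a)"

definition principal_symbol ::
  "nat \<Rightarrow> ('n::finite list \<Rightarrow> real ^ 'n \<Rightarrow> complex) \<Rightarrow> real ^ 'n \<Rightarrow> real ^ 'n \<Rightarrow> complex" where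
  "principal_symbol k a y \<xi> =
     (\<Sum>is | length is = k. a is y * (\<Prod>i\<leftarrow>is. \<i> * complex_of_real (\<xi> $ i)))"

definition elliptic_operator ::
  "('a, 'n::finite) chart set \<Rightarrow> (('a \<Rightarrow> complex) \<Rightarrow> 'a \<Rightarrow> complex) \<Rightarrow> bool" where
  "elliptic_operator A P \<longleftrightarrow>
     (\<exists>k. \<forall>c\<in>A. \<exists>a. local_form A c k P a \<and>
        (\<forall>y\<in>snd c ` fst c. \<forall>\<xi>. \<xi> \<noteq> 0 \<longrightarrow> principal_symbol k a y \<xi> \<noteq> 0))"

text \<open>The operators are given on smooth functions. Such an operator is self-adjoint in \<open>L\<^sup>2\<close> when its
  closure equals its Hilbert space adjoint; both are described here by their graphs.\<close>

definition closure_graph ::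
  "('a, 'n::finite) chart set \<Rightarrow> 'a measure \<Rightarrow> (('a \<Rightarrow> complex) \<Rightarrow> 'a \<Rightarrow> complex) \<Rightarrow>
   (('a \<Rightarrow> complex) \<times> ('a \<Rightarrow> complex)) set" where
  "closure_graph A \<mu> P =
     {(v, w). v \<in> Lp_space \<mu> 2 \<and> w \<in> Lp_space \<mu> 2 \<and>
        (\<exists>u. (\<forall>n. u n \<in> smooth_functions A) \<and>
           (\<lambda>n::nat. Lp_norm \<mu> 2 (\<lambda>x. u n x - v x)) \<longlonglongrightarrow> 0 \<and>
           (\<lambda>n. Lp_norm \<mu> 2 (\<lambda>x. P (u n) x - w x)) \<longlonglongrightarrow> 0)}"

definition adjoint_graph ::
  "('a, 'n::finite) chart set \<Rightarrow> 'a measure \<Rightarrow> (('a \<Rightarrow> complex) \<Rightarrow> 'a \<Rightarrow> complex) \<Rightarrow>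
   (('a \<Rightarrow> complex) \<times> ('a \<Rightarrow> complex)) set" where
  "adjoint_graph A \<mu> P =
     {(v, w). v \<in> Lp_space \<mu> 2 \<and> w \<in> Lp_space \<mu> 2 \<and>
        (\<forall>u\<in>smooth_functions A. L2_inner \<mu> (P u) v = L2_inner \<mu> u w)}"

definition self_adjoint_operator ::
  "('a, 'n::finite) chart set \<Rightarrow> 'a measure \<Rightarrow> (('a \<Rightarrow> complex) \<Rightarrow> 'a \<Rightarrow> complex) \<Rightarrow> bool" where
  "self_adjoint_operator A \<mu> P \<longleftrightarrow> closure_graph A \<mu> P = adjoint_graph A \<mu> P"

definition commuting_operators ::
  "'a set \<Rightarrow> ('a, 'n::finite) chart set \<Rightarrow> (('a \<Rightarrow> complex) \<Rightarrow> 'a \<Rightarrow> complex) \<Rightarrow>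
   (('a \<Rightarrow> complex) \<Rightarrow> 'a \<Rightarrow> complex) \<Rightarrow> bool" where
  "commuting_operators M A P Q \<longleftrightarrow> (\<forall>u\<in>smooth_functions A. \<forall>x\<in>M. P (Q u) x = Q (P u) x)"

definition jointly_elliptic ::
  "('a, 'n::finite) chart set \<Rightarrow> ('m::finite \<Rightarrow> ('a \<Rightarrow> complex) \<Rightarrow> 'a \<Rightarrow> complex) \<Rightarrow> bool" where
  "jointly_elliptic A L \<longleftrightarrow> elliptic_operator A (\<lambda>u x. u x + (\<Sum>i\<in>UNIV. L i (L i u) x))"

definition joint_elliptic_system ::
  "'a set \<Rightarrow> ('a, 'n::finite) chart set \<Rightarrow> 'a measure \<Rightarrow>
   ('m::finite \<Rightarrow> ('a \<Rightarrow> complex) \<Rightarrow> 'a \<Rightarrow> complex) \<Rightarrow> bool" where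
  "joint_elliptic_system M A \<mu> L \<longleftrightarrow>
     (\<forall>i. differential_operator A (L i)) \<and>
     (\<forall>i. self_adjoint_operator A \<mu> (L i)) \<and>
     (\<forall>i j. commuting_operators M A (L i) (L j)) \<and>
     jointly_elliptic A L"

text \<open>\<open>lam j\<close> is the vector of the eigenvalues of the operators \<open>L i\<close> on \<open>e j\<close>. Joint eigenfunctions
  are smooth by elliptic regularity, so \<open>L i\<close> is applied to them pointwise.\<close>

definition joint_eigenbasis ::
  "'a set \<Rightarrow> ('a, 'n::finite) chart set \<Rightarrow> 'a measure \<Rightarrow>
   ('m::finite \<Rightarrow> ('a \<Rightarrow> complex) \<Rightarrow> 'a \<Rightarrow> complex) \<Rightarrow>
   (nat \<Rightarrow> 'a \<Rightarrow> complex) \<Rightarrow> (nat \<Rightarrow> real ^ 'm) \<Rightarrow> bool" where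
  "joint_eigenbasis M A \<mu> L e lam \<longleftrightarrow>
     orthonormal_basis \<mu> e \<and>
     (\<forall>j. e j \<in> smooth_functions A) \<and>
     (\<forall>i j. \<forall>x\<in>M. L i (e j) x = complex_of_real (lam j $ i) * e j x)"

definition joint_spectrum :: "(nat \<Rightarrow> real ^ 'm) \<Rightarrow> (real ^ 'm) set" where
  "joint_spectrum lam = range lam"

end

theory Submission
  imports Defs
begin

text \<open>Only the orthonormal basis matters. For a finite \<open>F \<subseteq> X\<^sub>S\<close> let \<open>u\<close> be the projection of \<open>f\<close> onto
  the span of the \<open>e\<^sub>j\<close> with \<open>j \<in> F\<close>. Pointwise Cauchy-Schwarz bounds \<open>\<parallel>u\<parallel>\<^sup>2\<close> on \<open>E\<close> by
  \<open>\<parallel>f\<parallel>\<^sup>2 * (\<Sum>j\<in>F. \<integral>\<^sub>E \<bar>e\<^sub>j\<bar>\<^sup>2)\<close>, while \<open>\<parallel>f - u\<parallel>\<^sup>2 = \<parallel>f\<parallel>\<^sup>2 - (\<Sum>j\<in>F. \<bar>f\<^sub>j\<bar>\<^sup>2)\<close>, where the \<open>f\<^sub>j\<close> are the Fourier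
  coefficients. The norm of \<open>f\<close> on \<open>E\<close> is at least \<open>(1 - \<epsilon>) * \<parallel>f\<parallel>\<close>, and by Parseval
  \<open>\<parallel>f - u\<parallel>\<close> has a limit of at most \<open>\<epsilon>' * \<parallel>f\<parallel>\<close> as \<open>F\<close> exhausts \<open>X\<^sub>S\<close>. Passing to this
  limit covers infinite \<open>X\<^sub>S\<close> as well.\<close>

section \<open>Square-integrable functions as a vector space with inner product\<close>

lemma Lp_space_2_iff:
  "f \<in> Lp_space \<mu> 2 \<longleftrightarrow> f \<in> borel_measurable \<mu> \<and> integrable \<mu> (\<lambda>x. (norm (f x))\<^sup>2)"
  by (simp add: Lp_space_def)

lemma integrable_mult_cnj:
  assumes "f \<in> Lp_space \<mu> 2" "h \<in> Lp_space \<mu> 2"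
  shows "integrable \<mu> (\<lambda>x. f x * cnj (h x))"
proof (rule Bochner_Integration.integrable_bound)
  show "integrable \<mu> (\<lambda>x. (norm (f x))\<^sup>2 + (norm (h x))\<^sup>2)"
    using assms by (simp add: Lp_space_2_iff)
  have [measurable]: "f \<in> borel_measurable \<mu>" "h \<in> borel_measurable \<mu>"
    using assms by (auto simp: Lp_space_2_iff)
  show "(\<lambda>x. f x * cnj (h x)) \<in> borel_measurable \<mu>"
    by (intro borel_measurable_times borel_measurable_continuous_on[OF continuous_on_cnj[OF continuous_on_id]]) auto
  have "a * b \<le> a\<^sup>2 + b\<^sup>2" if "0 \<le> a" "0 \<le> b" for a b :: real
    using sum_squares_bound[of a b] mult_nonneg_nonneg[OF that] by linarith
  then show "AE x in \<mu>. norm (f x * cnj (h x)) \<le> norm ((norm (f x))\<^sup>2 + (norm (h x))\<^sup>2)"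
    by (simp add: norm_mult)
qed

lemma Lp_space_2_diff_scale:
  fixes f h :: "'a \<Rightarrow> complex"
  assumes "f \<in> Lp_space \<mu> 2" "h \<in> Lp_space \<mu> 2"
  shows "(\<lambda>x. f x - c * h x) \<in> Lp_space \<mu> 2"
  unfolding Lp_space_2_iff
proof
  have [measurable]: "f \<in> borel_measurable \<mu>" "h \<in> borel_measurable \<mu>"
    using assms by (auto simp: Lp_space_2_iff)
  show "(\<lambda>x. f x - c * h x) \<in> borel_measurable \<mu>"
    by measurable
  show "integrable \<mu> (\<lambda>x. (norm (f x - c * h x))\<^sup>2)"
  proof (rule Bochner_Integration.integrable_bound)
    show "integrable \<mu> (\<lambda>x. 2 * (norm (f x))\<^sup>2 + 2 * (norm c)\<^sup>2 * (norm (h x))\<^sup>2)"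
      using assms by (simp add: Lp_space_2_iff)
    have "(norm (a - b))\<^sup>2 \<le> 2 * (norm a)\<^sup>2 + 2 * (norm b)\<^sup>2" for a b :: complex
    proof -
      have "(norm (a - b))\<^sup>2 \<le> (norm a + norm b)\<^sup>2"
        by (simp add: norm_triangle_ineq4 power_mono)
      then show ?thesis
        using sum_squares_bound[of "norm a" "norm b"] unfolding power2_sum by linarith
    qed
    from this[of "f x" "c * h x" for x]
    show "AE x in \<mu>. norm ((norm (f x - c * h x))\<^sup>2)
        \<le> norm (2 * (norm (f x))\<^sup>2 + 2 * (norm c)\<^sup>2 * (norm (h x))\<^sup>2)"
      by (simp add: norm_mult power_mult_distrib mult.assoc)
  qed measurable
qed

lemma Lp_space_2_diff_sum:
  fixes f :: "'a \<Rightarrow> complex"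
  assumes "f \<in> Lp_space \<mu> 2" "\<And>j. e j \<in> Lp_space \<mu> 2" "finite F"
  shows "(\<lambda>x. f x - (\<Sum>j\<in>F. c j * e j x)) \<in> Lp_space \<mu> 2"
  using assms(3)
proof (induction F rule: finite_induct)
  case (insert k F)
  have "(\<lambda>x. (f x - (\<Sum>j\<in>F. c j * e j x)) - c k * e k x) \<in> Lp_space \<mu> 2"
    by (intro Lp_space_2_diff_scale insert assms)
  then show ?case
    using insert by (simp add: algebra_simps)
qed (simp add: assms(1))

section \<open>Fourier coefficients, Pythagoras and Parseval\<close>

lemma L2_inner_diff_scale_left:
  assumes "f \<in> Lp_space \<mu> 2" "h \<in> Lp_space \<mu> 2" "k \<in> Lp_space \<mu> 2"
  shows "L2_inner \<mu> (\<lambda>x. f x - c * h x) k = L2_inner \<mu> f k - c * L2_inner \<mu> h k"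
  using integrable_mult_cnj[OF assms(1,3)] integrable_mult_cnj[OF assms(2,3)]
  by (simp add: L2_inner_def left_diff_distrib mult.assoc)

text \<open>Each subtracted multiple of \<open>e j\<close> is orthogonal to \<open>e k\<close>. This
  supplies the cross term when \<open>k\<close> is added to \<open>F\<close> in
  \<open>integral_norm_diff_sum_squared\<close>.\<close>

lemma fourier_coeff_diff_sum:
  assumes e: "\<And>j. e j \<in> Lp_space \<mu> 2"
      "\<And>i j. L2_inner \<mu> (e i) (e j) = (if i = j then 1 else 0)"
    and f: "f \<in> Lp_space \<mu> 2" and "finite F" "k \<notin> F"
  shows "fourier_coeff \<mu> e (\<lambda>x. f x - (\<Sum>j\<in>F. c j * e j x)) k = fourier_coeff \<mu> e f k"
  using assms(4,5)
proof (induction F rule: finite_induct)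
  case (insert i F)
  have "fourier_coeff \<mu> e (\<lambda>x. (f x - (\<Sum>j\<in>F. c j * e j x)) - c i * e i x) k
      = fourier_coeff \<mu> e f k"
    using insert
    by (simp add: fourier_coeff_def L2_inner_diff_scale_left Lp_space_2_diff_sum e f)
  then show ?case
    using insert by (simp add: algebra_simps)
qed simp

text \<open>Serves twice in the next lemma: under the integral with \<open>z = h x\<close> and
  \<open>w = e k x\<close>, and with \<open>w = 1\<close> to complete the square in the
  coefficients.\<close>

lemma norm_diff_scale_squared:
  "(norm (z - c * w))\<^sup>2 = (norm z)\<^sup>2 - 2 * Re (cnj c * (z * cnj w)) + (norm c)\<^sup>2 * (norm w)\<^sup>2"
  for z c w :: complex
  unfolding cmod_power2 by (simp add: algebra_simps power2_eq_square)

text \<open>Pythagoras, one basis vector at a time. The \<open>c j\<close> stay arbitrary: Fourier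
  coefficients in their place give Bessel's identity, while the density in
  \<open>orthonormal_basis\<close> provides unspecified ones.\<close>

lemma integral_norm_diff_sum_squared:
  assumes e: "\<And>j. e j \<in> Lp_space \<mu> 2"
      "\<And>i j. L2_inner \<mu> (e i) (e j) = (if i = j then 1 else 0)"
    and f: "f \<in> Lp_space \<mu> 2" and "finite F"
  shows "(LINT x|\<mu>. (norm (f x - (\<Sum>j\<in>F. c j * e j x)))\<^sup>2)
    = (LINT x|\<mu>. (norm (f x))\<^sup>2) - (\<Sum>j\<in>F. (norm (fourier_coeff \<mu> e f j))\<^sup>2)
      + (\<Sum>j\<in>F. (norm (fourier_coeff \<mu> e f j - c j))\<^sup>2)"
  using assms(4)
proof (induction F rule: finite_induct)
  case (insert k F)
  define h where "h = (\<lambda>x. f x - (\<Sum>j\<in>F. c j * e j x))"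
  define a where "a = fourier_coeff \<mu> e f"
  have h: "h \<in> Lp_space \<mu> 2"
    unfolding h_def by (intro Lp_space_2_diff_sum f e insert)
  have hk: "(LINT x|\<mu>. h x * cnj (e k x)) = a k"
    using fourier_coeff_diff_sum[OF e f, of F k c] insert
    by (simp add: fourier_coeff_def L2_inner_def h_def a_def)
  have "complex_of_real (LINT x|\<mu>. (norm (e k x))\<^sup>2) = L2_inner \<mu> (e k) (e k)"
    unfolding L2_inner_def complex_norm_square[symmetric] by (simp only: integral_complex_of_real)
  then have ek: "(LINT x|\<mu>. (norm (e k x))\<^sup>2) = 1"
    by (simp add: e(2))
  define R where "R = (\<lambda>x. Re (cnj (c k) * (h x * cnj (e k x))))"
  have intR: "integrable \<mu> R"
    unfolding R_def by (intro integrable_Re integrable_mult_right integrable_mult_cnj h e)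
  have "(LINT x|\<mu>. R x) = Re (LINT x|\<mu>. cnj (c k) * (h x * cnj (e k x)))"
    unfolding R_def by (intro integral_Re integrable_mult_right integrable_mult_cnj h e)
  then have R: "(LINT x|\<mu>. R x) = Re (cnj (c k) * a k)"
    by (simp only: integral_mult_right_zero hk)
  have "(LINT x|\<mu>. (norm (h x - c k * e k x))\<^sup>2)
      = (LINT x|\<mu>. (norm (h x))\<^sup>2 - 2 * R x + (norm (c k))\<^sup>2 * (norm (e k x))\<^sup>2)"
    by (simp only: norm_diff_scale_squared R_def)
  also have "\<dots> = (LINT x|\<mu>. (norm (h x))\<^sup>2) - 2 * (LINT x|\<mu>. R x) + (norm (c k))\<^sup>2"
    using h e(1)[of k] intR ek by (simp add: Lp_space_2_iff)
  also have "\<dots> = (LINT x|\<mu>. (norm (h x))\<^sup>2) - 2 * Re (cnj (c k) * a k) + (norm (c k))\<^sup>2"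
    by (simp only: R)
  also have "\<dots> = (LINT x|\<mu>. (norm (h x))\<^sup>2) - (norm (a k))\<^sup>2 + (norm (a k - c k))\<^sup>2"
    using norm_diff_scale_squared[of "a k" "c k" 1] by simp
  finally show ?case
    using insert by (simp add: h_def a_def algebra_simps)
qed simp

text \<open>No choice of \<open>c\<close> beats the Fourier coefficients: the squared error is at
  least the squared norm minus a partial sum, and density makes it arbitrarily small.\<close>

lemma Parseval_le_suminf:
  assumes basis: "orthonormal_basis \<mu> e" and f: "f \<in> Lp_space \<mu> 2"
    and sm: "summable (\<lambda>j. (norm (fourier_coeff \<mu> e f j))\<^sup>2)"
  shows "(LINT x|\<mu>. (norm (f x))\<^sup>2) \<le> (\<Sum>j. (norm (fourier_coeff \<mu> e f j))\<^sup>2)"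
proof (rule field_le_epsilon)
  fix \<delta> :: real assume "0 < \<delta>"
  \<comment> \<open>\<open>Lp_norm\<close> contains the square root, so accuracy
    \<open>sqrt \<delta>\<close> means a squared error below \<delta>.\<close>
  then obtain N c where "Lp_norm \<mu> 2 (\<lambda>x. f x - (\<Sum>j<N. c j * e j x)) < sqrt \<delta>"
    using basis f unfolding orthonormal_basis_def by (meson real_sqrt_gt_zero)
  then have "(LINT x|\<mu>. (norm (f x - (\<Sum>j<N. c j * e j x)))\<^sup>2) < \<delta>"
    by (simp add: Lp_norm_def powr_half_sqrt)
  moreover have "(LINT x|\<mu>. (norm (f x - (\<Sum>j<N. c j * e j x)))\<^sup>2)
      \<ge> (LINT x|\<mu>. (norm (f x))\<^sup>2) - (\<Sum>j<N. (norm (fourier_coeff \<mu> e f j))\<^sup>2)"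
    using basis f by (subst integral_norm_diff_sum_squared)
      (auto simp: orthonormal_basis_def sum_nonneg)
  moreover have "(\<Sum>j<N. (norm (fourier_coeff \<mu> e f j))\<^sup>2) \<le> (\<Sum>j. (norm (fourier_coeff \<mu> e f j))\<^sup>2)"
    using sm by (intro sum_le_suminf) auto
  ultimately show "(LINT x|\<mu>. (norm (f x))\<^sup>2) \<le> (\<Sum>j. (norm (fourier_coeff \<mu> e f j))\<^sup>2) + \<delta>"
    by linarith
qed

section \<open>Concentration in squared form, Minkowski and Cauchy-Schwarz\<close>

text \<open>The level is calibrated so that, for measurable \<open>E\<close>, at most the fraction
  \<open>\<epsilon>\<^sup>2\<close> of the squared norm lies outside \<open>E\<close>. The measure
  is general because both \<open>f\<close> and its sequence of coefficients are treated this
  way.\<close>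

lemma Lp_concentrated_2_imp_le:
  assumes "Lp_concentrated \<mu> 2 E ((1 - \<epsilon>\<^sup>2) powr (- 1 / 2)) f" "0 \<le> \<epsilon>" "\<epsilon> < 1"
  shows "(1 - \<epsilon>\<^sup>2) * (LINT x|\<mu>. (norm (f x))\<^sup>2) \<le> (LINT x:E|\<mu>. (norm (f x))\<^sup>2)"
proof -
  have pos: "0 < 1 - \<epsilon>\<^sup>2"
    using assms by (simp add: power_less_one_iff abs_square_less_1)
  have nn: "0 \<le> (LINT x|\<mu>. (norm (f x))\<^sup>2)" "0 \<le> (LINT x:E|\<mu>. (norm (f x))\<^sup>2)"
    by (auto simp: set_lebesgue_integral_def)
  have "(1 - \<epsilon>\<^sup>2) powr (- 1 / 2) = 1 / sqrt (1 - \<epsilon>\<^sup>2)"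
    using pos by (simp add: powr_minus_divide powr_half_sqrt)
  with assms(1) nn have "sqrt (LINT x|\<mu>. (norm (f x))\<^sup>2)
      \<le> 1 / sqrt (1 - \<epsilon>\<^sup>2) * sqrt (LINT x:E|\<mu>. (norm (f x))\<^sup>2)"
    by (simp add: Lp_concentrated_def powr_half_sqrt)
  then have "sqrt (1 - \<epsilon>\<^sup>2) * sqrt (LINT x|\<mu>. (norm (f x))\<^sup>2) \<le> sqrt (LINT x:E|\<mu>. (norm (f x))\<^sup>2)"
    using pos by (simp add: field_simps)
  then show ?thesis by (simp only: real_sqrt_le_iff flip: real_sqrt_mult)
qed

text \<open>Weighting by \<open>t = c / b\<close> in \<open>\<bar>u + v\<bar>\<^sup>2 \<le> (1 + t) \<bar>u\<bar>\<^sup>2 + (1 + 1/t) \<bar>v\<bar>\<^sup>2\<close>, where \<open>b\<close> and \<open>c\<close> are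
  slightly larger than the two norms on the right, avoids the Cauchy-Schwarz inequality.\<close>

lemma Minkowski_2_set_integral:
  fixes u v :: "'a \<Rightarrow> complex"
  assumes u: "set_integrable \<mu> E (\<lambda>x. (norm (u x))\<^sup>2)" and v: "set_integrable \<mu> E (\<lambda>x. (norm (v x))\<^sup>2)"
    and uv: "set_integrable \<mu> E (\<lambda>x. (norm (u x + v x))\<^sup>2)"
  shows "sqrt (LINT x:E|\<mu>. (norm (u x + v x))\<^sup>2)
    \<le> sqrt (LINT x:E|\<mu>. (norm (u x))\<^sup>2) + sqrt (LINT x:E|\<mu>. (norm (v x))\<^sup>2)"
    (is "sqrt ?A \<le> sqrt ?B + sqrt ?C")
proof (rule field_le_epsilon)
  fix \<eta> :: real assume "0 < \<eta>"
  have nn: "0 \<le> ?B" "0 \<le> ?C"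
    by (auto simp: set_lebesgue_integral_def)
  \<comment> \<open>The padding keeps both quotients meaningful when an integral vanishes, and its
    two halves add up to \<eta>.\<close>
  define b c where "b = sqrt ?B + \<eta> / 2" and "c = sqrt ?C + \<eta> / 2"
  have bc: "0 < b" "0 < c"
    using nn \<open>0 < \<eta>\<close> by (auto simp: b_def c_def add_nonneg_pos)
  have le: "?B \<le> b\<^sup>2" "?C \<le> c\<^sup>2"
    using nn \<open>0 < \<eta>\<close> by (auto intro!: sqrt_le_D simp: b_def c_def)
  have pt: "(norm (p + q))\<^sup>2 \<le> (1 + c / b) * (norm p)\<^sup>2 + (1 + b / c) * (norm q)\<^sup>2" for p q :: complex
  proof -
    have "0 \<le> (c * norm p - b * norm q)\<^sup>2 / (b * c)"
      using bc by simp
    also have "\<dots> = c / b * (norm p)\<^sup>2 + b / c * (norm q)\<^sup>2 - 2 * norm p * norm q"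
      using bc by (simp add: field_simps power2_eq_square)
    finally have "2 * norm p * norm q \<le> c / b * (norm p)\<^sup>2 + b / c * (norm q)\<^sup>2"
      by linarith
    moreover have "(norm (p + q))\<^sup>2 \<le> (norm p + norm q)\<^sup>2"
      by (simp add: norm_triangle_ineq power_mono)
    ultimately show ?thesis
      by (simp add: power2_sum distrib_right)
  qed
  have "?A \<le> (LINT x:E|\<mu>. (1 + c / b) * (norm (u x))\<^sup>2 + (1 + b / c) * (norm (v x))\<^sup>2)"
    using u v uv pt by (intro set_integral_mono set_integral_add set_integrable_mult_right) auto
  also have "\<dots> = (1 + c / b) * ?B + (1 + b / c) * ?C"
    using u v by simp
  also have "\<dots> \<le> (1 + c / b) * b\<^sup>2 + (1 + b / c) * c\<^sup>2"
    using bc le by (intro add_mono mult_left_mono) auto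
  also have "\<dots> = (b + c)\<^sup>2"
    using bc by (simp add: field_simps power2_eq_square)
  finally have "sqrt ?A \<le> b + c"
    using bc by (intro real_le_lsqrt) auto
  then show "sqrt ?A \<le> sqrt ?B + sqrt ?C + \<eta>"
    by (simp add: b_def c_def)
qed

text \<open>Cauchy-Schwarz for sums. Applied at each point \<open>x\<close>, it separates the
  coefficients of the projection from the values \<open>e j x\<close>.\<close>

lemma norm_sum_mult_squared_le:
  fixes a z :: "'i \<Rightarrow> complex"
  shows "(norm (\<Sum>j\<in>F. a j * z j))\<^sup>2 \<le> (\<Sum>j\<in>F. (norm (a j))\<^sup>2) * (\<Sum>j\<in>F. (norm (z j))\<^sup>2)"
proof -
  have "norm (\<Sum>j\<in>F. a j * z j) \<le> (\<Sum>j\<in>F. \<bar>norm (a j)\<bar> * \<bar>norm (z j)\<bar>)"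
    by (rule order.trans[OF norm_sum]) (simp add: norm_mult)
  also have "\<dots> \<le> L2_set (\<lambda>j. norm (a j)) F * L2_set (\<lambda>j. norm (z j)) F"
    by (rule L2_set_mult_ineq)
  finally have "(norm (\<Sum>j\<in>F. a j * z j))\<^sup>2 \<le> (L2_set (\<lambda>j. norm (a j)) F * L2_set (\<lambda>j. norm (z j)) F)\<^sup>2"
    by (simp add: power_mono)
  then show ?thesis
    by (simp add: power_mult_distrib L2_set_def sum_nonneg)
qed

section \<open>The bound for finite index sets and its limit\<close>

text \<open>Triangle inequality on \<open>E\<close> for \<open>f = u + (f - u)\<close>.
  Cauchy-Schwarz controls \<open>u\<close>; the integral of the remainder is enlarged to the whole
  space, where orthogonality gives it exactly.\<close>

lemma concentration_finite_bound:
  assumes basis: "orthonormal_basis \<mu> e" and f: "f \<in> Lp_space \<mu> 2" and E: "E \<in> sets \<mu>"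
    and F: "finite F"
  defines "a \<equiv> fourier_coeff \<mu> e f" and "I \<equiv> LINT x|\<mu>. (norm (f x))\<^sup>2"
  shows "sqrt (LINT x:E|\<mu>. (norm (f x))\<^sup>2)
    \<le> sqrt (I * (\<Sum>j\<in>F. LINT x:E|\<mu>. (norm (e j x))\<^sup>2)) + sqrt (I - (\<Sum>j\<in>F. (norm (a j))\<^sup>2))"
proof -
  have e: "\<And>j. e j \<in> Lp_space \<mu> 2" "\<And>i j. L2_inner \<mu> (e i) (e j) = (if i = j then 1 else 0)"
    using basis by (auto simp: orthonormal_basis_def)
  have restr: "set_integrable \<mu> E (\<lambda>x. (norm (h x))\<^sup>2)" if "h \<in> Lp_space \<mu> 2" for h :: "'a \<Rightarrow> complex"
    using that integrable_mult_indicator[OF E, of "\<lambda>x. (norm (h x))\<^sup>2"]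
    by (simp add: Lp_space_2_iff set_integrable_def)
  define u where "u = (\<lambda>x. \<Sum>j\<in>F. a j * e j x)"
  have v: "(\<lambda>x. f x - u x) \<in> Lp_space \<mu> 2"
    unfolding u_def by (intro Lp_space_2_diff_sum f e F)
  have "(\<lambda>x. f x - 1 * (f x - u x)) \<in> Lp_space \<mu> 2"
    by (intro Lp_space_2_diff_scale f v)
  then have u: "u \<in> Lp_space \<mu> 2" by simp
  have bessel: "(LINT x|\<mu>. (norm (f x - u x))\<^sup>2) = I - (\<Sum>j\<in>F. (norm (a j))\<^sup>2)"
    unfolding u_def I_def a_def using integral_norm_diff_sum_squared[OF e f F] by simp
  \<comment> \<open>Bessel's inequality, which lets \<open>I\<close>, a factor independent of
    \<open>F\<close>, replace the sum of the squared coefficients.\<close>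
  have aI: "(\<Sum>j\<in>F. (norm (a j))\<^sup>2) \<le> I"
    using bessel Bochner_Integration.integral_nonneg[of \<mu> "\<lambda>x. (norm (f x - u x))\<^sup>2"] by simp
  have "(LINT x:E|\<mu>. (norm (u x))\<^sup>2) \<le> (LINT x:E|\<mu>. \<Sum>j\<in>F. I * (norm (e j x))\<^sup>2)"
  proof (rule set_integral_mono)
    fix x
    have "(norm (u x))\<^sup>2 \<le> (\<Sum>j\<in>F. (norm (a j))\<^sup>2) * (\<Sum>j\<in>F. (norm (e j x))\<^sup>2)"
      unfolding u_def by (rule norm_sum_mult_squared_le)
    also have "\<dots> \<le> I * (\<Sum>j\<in>F. (norm (e j x))\<^sup>2)"
      by (intro mult_right_mono aI sum_nonneg) simp
    finally show "(norm (u x))\<^sup>2 \<le> (\<Sum>j\<in>F. I * (norm (e j x))\<^sup>2)"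
      by (simp add: sum_distrib_left)
  qed (use restr[OF u] restr[OF e(1)] in \<open>auto simp: set_integrable_def sum_distrib_left mult.left_commute[of _ I]\<close>)
  also have "\<dots> = I * (\<Sum>j\<in>F. LINT x:E|\<mu>. (norm (e j x))\<^sup>2)"
    using restr[OF e(1)] F
    by (simp add: set_lebesgue_integral_def set_integrable_def sum_distrib_left mult.left_commute[of _ I])
  finally have 1: "(LINT x:E|\<mu>. (norm (u x))\<^sup>2) \<le> I * (\<Sum>j\<in>F. LINT x:E|\<mu>. (norm (e j x))\<^sup>2)" .
  have 2: "(LINT x:E|\<mu>. (norm (f x - u x))\<^sup>2) \<le> I - (\<Sum>j\<in>F. (norm (a j))\<^sup>2)"
    unfolding bessel[symmetric] set_lebesgue_integral_def
    using v restr[OF v] by (intro integral_mono) (auto simp: Lp_space_2_iff set_integrable_def indicator_def)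
  have "sqrt (LINT x:E|\<mu>. (norm (f x))\<^sup>2)
      \<le> sqrt (LINT x:E|\<mu>. (norm (u x))\<^sup>2) + sqrt (LINT x:E|\<mu>. (norm (f x - u x))\<^sup>2)"
    using Minkowski_2_set_integral[OF restr[OF u] restr[OF v]] restr[OF f] by simp
  with 1 2 show ?thesis
    by (meson add_mono order_trans real_sqrt_le_mono)
qed

text \<open>Extended nonnegative reals accommodate an infinite \<open>X\<close>. An infinite sum
  leaves nothing to show; a finite value \<open>K\<close> bounds the sums over all truncations
  \<open>X \<inter> {..<n}\<close>, so \<open>n\<close> can tend to infinity with \<open>K\<close>
  fixed.\<close>

lemma nn_integral_concentration_bound:
  assumes basis: "orthonormal_basis \<mu> e" and f: "f \<in> Lp_space \<mu> 2" and E: "E \<in> sets \<mu>"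
    and nz: "\<not> (AE x in \<mu>. f x = 0)"
    and eps: "0 \<le> \<epsilon>" "\<epsilon> < 1" "0 \<le> \<epsilon>'" "\<epsilon>' < 1" "\<epsilon> + \<epsilon>' \<le> 1"
    and concE: "Lp_concentrated \<mu> 2 E ((1 - \<epsilon>\<^sup>2) powr (- 1 / 2)) f"
    and concX: "Lp_concentrated (count_space UNIV) 2 X ((1 - \<epsilon>'\<^sup>2) powr (- 1 / 2)) (fourier_coeff \<mu> e f)"
  shows "ennreal ((1 - \<epsilon> - \<epsilon>')\<^sup>2) \<le> (\<Sum>\<^sub>\<infinity>j\<in>X. \<integral>\<^sup>+x\<in>E. ennreal ((norm (e j x))\<^sup>2) \<partial>\<mu>)"
    (is "_ \<le> ?K")
proof (cases ?K rule: ennreal_cases)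
  case K: (real K)
  define a where "a = fourier_coeff \<mu> e f"
  define I where "I = (LINT x|\<mu>. (norm (f x))\<^sup>2)"
  define s where "s = (\<lambda>n. \<Sum>j\<in>X \<inter> {..<n}. (norm (a j))\<^sup>2)"
  \<comment> \<open>Nontriviality of \<open>f\<close> makes \<open>I\<close> positive, so that
    \<open>sqrt I\<close> can be cancelled at the end.\<close>
  have "I \<noteq> 0"
    using nz f integral_nonneg_eq_0_iff_AE[of \<mu> "\<lambda>x. (norm (f x))\<^sup>2"]
    by (auto simp: I_def Lp_space_2_iff)
  then have I: "0 < I"
    by (simp add: I_def order_less_le)
  have int: "integrable \<mu> (\<lambda>x. indicator E x *\<^sub>R (norm (e j x))\<^sup>2)" for j
    using basis integrable_mult_indicator[OF E, of "\<lambda>x. (norm (e j x))\<^sup>2"]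
    by (simp add: Lp_space_2_iff orthonormal_basis_def)
  have sumK: "(\<Sum>j\<in>X \<inter> {..<n}. LINT x:E|\<mu>. (norm (e j x))\<^sup>2) \<le> K" for n
  proof -
    have "ennreal (\<Sum>j\<in>X \<inter> {..<n}. LINT x:E|\<mu>. (norm (e j x))\<^sup>2)
        = (\<Sum>j\<in>X \<inter> {..<n}. \<integral>\<^sup>+x\<in>E. ennreal ((norm (e j x))\<^sup>2) \<partial>\<mu>)"
    proof (subst sum_ennreal[symmetric])
      show "0 \<le> (LINT x:E|\<mu>. (norm (e j x))\<^sup>2)" for j
        by (auto simp: set_lebesgue_integral_def)
      have "ennreal (LINT x:E|\<mu>. (norm (e j x))\<^sup>2) = (\<integral>\<^sup>+x\<in>E. ennreal ((norm (e j x))\<^sup>2) \<partial>\<mu>)" for j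
        unfolding set_lebesgue_integral_def
        by (subst nn_integral_eq_integral[symmetric, OF int])
           (auto intro!: nn_integral_cong simp: indicator_def)
      then show "(\<Sum>j\<in>X \<inter> {..<n}. ennreal (LINT x:E|\<mu>. (norm (e j x))\<^sup>2))
          = (\<Sum>j\<in>X \<inter> {..<n}. \<integral>\<^sup>+x\<in>E. ennreal ((norm (e j x))\<^sup>2) \<partial>\<mu>)"
        by simp
    qed
    also have "\<dots> \<le> ?K"
      by (subst nonneg_infsum_complete) (auto intro!: SUP_upper)
    finally show ?thesis
      unfolding K(2) by (simp only: ennreal_le_iff K(1))
  qed
  \<comment> \<open>Square-summability is part of \<open>concX\<close>, since
    \<open>Lp_concentrated\<close> includes membership in \<open>Lp_space\<close>.\<close>
  have sm: "summable (\<lambda>j. (norm (a j))\<^sup>2)"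
    using concX by (simp add: Lp_concentrated_def Lp_space_2_iff integrable_count_space_nat_iff a_def)
  have smX: "summable (\<lambda>j. indicator X j * (norm (a j))\<^sup>2)"
    by (rule summable_comparison_test'[OF sm, of 0]) (auto simp: indicator_def)
  \<comment> \<open>Parseval turns concentration of the coefficients into a bound relative to the
    norm of \<open>f\<close> itself.\<close>
  have "(1 - \<epsilon>'\<^sup>2) * I \<le> (1 - \<epsilon>'\<^sup>2) * (\<Sum>j. (norm (a j))\<^sup>2)"
    using Parseval_le_suminf[OF basis f] sm eps
    by (intro mult_left_mono) (auto simp: a_def I_def power_le_one)
  also have "\<dots> \<le> (\<Sum>j. indicator X j * (norm (a j))\<^sup>2)"
    using Lp_concentrated_2_imp_le[OF concX] eps sm smX
    by (simp add: set_lebesgue_integral_def integral_count_space_nat integrable_count_space_nat_iff a_def)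
  finally have limit_ge: "(1 - \<epsilon>'\<^sup>2) * I \<le> (\<Sum>j. indicator X j * (norm (a j))\<^sup>2)" (is "_ \<le> ?s") .
  have "s = (\<lambda>n. \<Sum>j<n. indicator X j * (norm (a j))\<^sup>2)"
    unfolding s_def by (intro ext sum.mono_neutral_cong_left) (auto simp: indicator_def)
  then have "s \<longlonglongrightarrow> ?s"
    using summable_LIMSEQ[OF smX] by simp
  then have lim: "(\<lambda>n. sqrt (I * K) + sqrt (I - s n)) \<longlonglongrightarrow> sqrt (I * K) + sqrt (I - ?s)"
    by (intro tendsto_intros)
  have step: "sqrt (LINT x:E|\<mu>. (norm (f x))\<^sup>2) \<le> sqrt (I * K) + sqrt (I - s n)" for n
  proof -
    have "sqrt (I * (\<Sum>j\<in>X \<inter> {..<n}. LINT x:E|\<mu>. (norm (e j x))\<^sup>2)) \<le> sqrt (I * K)"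
      using sumK I by simp
    then show ?thesis
      using concentration_finite_bound[OF basis f E, of "X \<inter> {..<n}", OF finite_Int[OF disjI2[OF finite_lessThan]]]
      unfolding s_def I_def a_def by linarith
  qed
  \<comment> \<open>Concentration on \<open>E\<close> gives the factor
    \<open>sqrt (1 - \<epsilon>\<^sup>2)\<close>, which is at least \<open>1 - \<epsilon>\<close> on
    the unit interval.\<close>
  have "(1 - \<epsilon>) * sqrt I = sqrt ((1 - \<epsilon>)\<^sup>2 * I)"
    using eps by (simp add: real_sqrt_mult)
  also have "\<dots> \<le> sqrt ((1 - \<epsilon>\<^sup>2) * I)"
  proof -
    have "\<epsilon>\<^sup>2 \<le> \<epsilon>" using eps by (simp add: power2_eq_square mult_left_le)
    then have "(1 - \<epsilon>)\<^sup>2 \<le> 1 - \<epsilon>\<^sup>2" by (simp add: power2_diff)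
    then show ?thesis using I by simp
  qed
  also have "\<dots> \<le> sqrt (LINT x:E|\<mu>. (norm (f x))\<^sup>2)"
    using Lp_concentrated_2_imp_le[OF concE] eps by (simp add: I_def)
  also have "\<dots> \<le> sqrt (I * K) + sqrt (I - ?s)"
    by (rule LIMSEQ_le_const[OF lim]) (use step in auto)
  also have "\<dots> \<le> sqrt (I * K) + sqrt (\<epsilon>'\<^sup>2 * I)"
    using limit_ge by (simp add: algebra_simps)
  also have "\<dots> = (sqrt K + \<epsilon>') * sqrt I"
    using eps by (simp add: real_sqrt_mult algebra_simps)
  finally have "1 - \<epsilon> - \<epsilon>' \<le> sqrt K"
    using I by simp
  \<comment> \<open>Squaring preserves the inequality because
    \<open>\<epsilon> + \<epsilon>' \<le> 1\<close> makes the smaller side nonnegative.\<close>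
  then have "(1 - \<epsilon> - \<epsilon>')\<^sup>2 \<le> (sqrt K)\<^sup>2"
    using eps by (intro power_mono) auto
  then show ?thesis
    unfolding K(2) by (intro ennreal_leI) (simp add: K(1))
next
  case top
  then show ?thesis
    by (simp only: top_greatest)
qed

theorem proposition1p17:
  fixes M :: "'a::t2_space set"
    and A :: "('a, 'n::finite) chart set"
    and g :: "('a, 'n) chart \<Rightarrow> real ^ 'n \<Rightarrow> real ^ 'n ^ 'n"
    and dx :: "'a measure"
    and D :: "'m::finite \<Rightarrow> ('a \<Rightarrow> complex) \<Rightarrow> 'a \<Rightarrow> complex"
    and e :: "nat \<Rightarrow> 'a \<Rightarrow> complex"
    and lam :: "nat \<Rightarrow> real ^ 'm"
    and E :: "'a set"
    and S :: "(real ^ 'm) set"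
    and X\<^sub>S :: "nat set"
    and f :: "'a \<Rightarrow> complex"
    and L L' \<epsilon> \<epsilon>' :: real
  assumes "compact_riemannian_manifold M A g"
    and "riemannian_volume M A g dx"
    and "joint_elliptic_system M A dx D"
    and "joint_eigenbasis M A dx D e lam"
    and "E \<in> sets dx"
    and "finite S" and "S \<subseteq> joint_spectrum lam"
    and "X\<^sub>S = {j. lam j \<in> S}"
    and "0 \<le> \<epsilon>" and "\<epsilon> < 1" and "0 \<le> \<epsilon>'" and "\<epsilon>' < 1"
    and "\<epsilon> + \<epsilon>' \<le> 1"
    and "L = (1 - \<epsilon>\<^sup>2) powr (- 1 / 2)" and "L' = (1 - \<epsilon>'\<^sup>2) powr (- 1 / 2)"
    and "f \<in> Lp_space dx 2" and "\<not> (AE x in dx. f x = 0)"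
    and "Lp_concentrated dx 2 E L f"
    and "Lp_concentrated (count_space UNIV) 2 X\<^sub>S L' (fourier_coeff dx e f)"
  shows "(\<Sum>\<^sub>\<infinity>j\<in>X\<^sub>S. \<integral>\<^sup>+x\<in>E. ennreal ((norm (e j x))\<^sup>2) \<partial>dx) \<ge> ennreal ((1 - \<epsilon> - \<epsilon>')\<^sup>2)"
  using assms unfolding joint_eigenbasis_def
  by (intro nn_integral_concentration_bound[where f = f]) simp_all

end
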